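(* Let $(X,+)$ be an abelian normal subgroup of a Moufang loop $(Q,\cdot)$ and let $a\in Q$. Let $f$ be the restriction of $T_a$ to $X$. Then $f$ is a Moufang permutation on $(X,+)$, with associated biadditive mapping $\beta(x,y)=f^{-1}(f(x)+f(y))-x-y$, and for all integers $i,j$ and all $x,y\in X$: $$a^{3i}x\cdot ya^{3j}=a^{3(i+j)}\Big(f^{-3j}(x)+f^{-3j}(y)+\sum_{k\in I(-2j,i)}f^{-3k}(\beta(x,y))\Big),$$ $$a^{3i}x\cdot a^{3j}y=a^{3(i+j)}\Big(f^{-3j}(x)+y+\sum_{k\in I(i+j,-j)}f^{-3k}(\beta(x,y))\Big).$$
   Context: A loop is Moufang if it satisfies $xy\cdot zx=(x\cdot yz)x$ for all $x,y,z$; Moufang loops are diassociative, so powers are well defined. $T_a(x)=axa^{-1}$ (i.e. $T_a=R_a^{-1}L_a$). Products of elements of $X$ in $Q$ are written $x+y$; juxtaposition binds tighter than $\cdot$. A permutation $f$ of an abelian group $(X,+)$ is a Moufang permutation if the map $\beta(x,y)=f^{-1}(f(x)+f(y))-x-y$ is symmetric, alternating and biadditive, and for all $x,y,z$: $\beta(\beta(x,y),z)=0$ and $\beta(f(x),f(y))=f(\beta(f^3(x),y))$. $I(i,j)$ is $\emptyset$ if $i=j$, $\{i,\dots,j-1\}$ if $i<j$, $\{j,\dots,i-1\}$ if $j<i$. *)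

theory Defs
  imports "HOL-Algebra.FiniteProduct"
begin

definition is_loop :: "'a set \<Rightarrow> ('a \<Rightarrow> 'a \<Rightarrow> 'a) \<Rightarrow> 'a \<Rightarrow> bool" where
  "is_loop Q m e \<longleftrightarrow> e \<in> Q \<and> (\<forall>x\<in>Q. \<forall>y\<in>Q. m x y \<in> Q)
     \<and> (\<forall>x\<in>Q. m e x = x \<and> m x e = x)
     \<and> (\<forall>a\<in>Q. \<forall>b\<in>Q. \<exists>!x. x \<in> Q \<and> m a x = b)
     \<and> (\<forall>a\<in>Q. \<forall>b\<in>Q. \<exists>!y. y \<in> Q \<and> m y a = b)"

definition moufang_loop :: "'a set \<Rightarrow> ('a \<Rightarrow> 'a \<Rightarrow> 'a) \<Rightarrow> 'a \<Rightarrow> bool" where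
  "moufang_loop Q m e \<longleftrightarrow> is_loop Q m e
     \<and> (\<forall>x\<in>Q. \<forall>y\<in>Q. \<forall>z\<in>Q. m (m x y) (m z x) = m (m x (m y z)) x)"

definition rdiv :: "'a set \<Rightarrow> ('a \<Rightarrow> 'a \<Rightarrow> 'a) \<Rightarrow> 'a \<Rightarrow> 'a \<Rightarrow> 'a" where
  "rdiv Q m b a = (THE y. y \<in> Q \<and> m y a = b)"

definition Tmap :: "'a set \<Rightarrow> ('a \<Rightarrow> 'a \<Rightarrow> 'a) \<Rightarrow> 'a \<Rightarrow> 'a \<Rightarrow> 'a" where
  "Tmap Q m a x = rdiv Q m (m a x) a"

text \<open>Inverse of an element (unique x with a x = e; two-sided in a Moufang loop).\<close>
definition linv :: "'a set \<Rightarrow> ('a \<Rightarrow> 'a \<Rightarrow> 'a) \<Rightarrow> 'a \<Rightarrow> 'a \<Rightarrow> 'a" where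
  "linv Q m e a = (THE x. x \<in> Q \<and> m a x = e)"

primrec npow :: "('a \<Rightarrow> 'a \<Rightarrow> 'a) \<Rightarrow> 'a \<Rightarrow> 'a \<Rightarrow> nat \<Rightarrow> 'a" where
  "npow m e a 0 = e"
| "npow m e a (Suc n) = m a (npow m e a n)"

text \<open>Integer powers (well defined by diassociativity).\<close>
definition zpow :: "'a set \<Rightarrow> ('a \<Rightarrow> 'a \<Rightarrow> 'a) \<Rightarrow> 'a \<Rightarrow> 'a \<Rightarrow> int \<Rightarrow> 'a" where
  "zpow Q m e a i = (if 0 \<le> i then npow m e a (nat i) else npow m e (linv Q m e a) (nat (- i)))"

definition normal_subloop :: "'a set \<Rightarrow> ('a \<Rightarrow> 'a \<Rightarrow> 'a) \<Rightarrow> 'a \<Rightarrow> 'a set \<Rightarrow> bool" where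
  "normal_subloop Q m e S \<longleftrightarrow> S \<subseteq> Q \<and> is_loop S m e
     \<and> (\<forall>x\<in>Q. \<forall>y\<in>Q.
          (\<lambda>s. m x s) ` S = (\<lambda>s. m s x) ` S
        \<and> (\<lambda>s. m (m x s) y) ` S = (\<lambda>s. m x (m s y)) ` S
        \<and> (\<lambda>s. m x (m y s)) ` S = (\<lambda>s. m (m x y) s) ` S)"

definition perm_zpow :: "'a set \<Rightarrow> ('a \<Rightarrow> 'a) \<Rightarrow> int \<Rightarrow> 'a \<Rightarrow> 'a" where
  "perm_zpow X f n = (if 0 \<le> n then f ^^ nat n else inv_into X f ^^ nat (- n))"

definition mbeta :: "('a, 'b) monoid_scheme \<Rightarrow> ('a \<Rightarrow> 'a) \<Rightarrow> 'a \<Rightarrow> 'a \<Rightarrow> 'a" where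
  "mbeta G f x y = inv_into (carrier G) f (f x \<otimes>\<^bsub>G\<^esub> f y) \<otimes>\<^bsub>G\<^esub> inv\<^bsub>G\<^esub> x \<otimes>\<^bsub>G\<^esub> inv\<^bsub>G\<^esub> y"

definition moufang_perm :: "('a, 'b) monoid_scheme \<Rightarrow> ('a \<Rightarrow> 'a) \<Rightarrow> bool" where
  "moufang_perm G f \<longleftrightarrow> bij_betw f (carrier G) (carrier G)
     \<and> (\<forall>x\<in>carrier G. \<forall>y\<in>carrier G. mbeta G f x y = mbeta G f y x)
     \<and> (\<forall>x\<in>carrier G. mbeta G f x x = \<one>\<^bsub>G\<^esub>)
     \<and> (\<forall>x\<in>carrier G. \<forall>y\<in>carrier G. \<forall>z\<in>carrier G.
           mbeta G f (x \<otimes>\<^bsub>G\<^esub> y) z = mbeta G f x z \<otimes>\<^bsub>G\<^esub> mbeta G f y z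
         \<and> mbeta G f x (y \<otimes>\<^bsub>G\<^esub> z) = mbeta G f x y \<otimes>\<^bsub>G\<^esub> mbeta G f x z)
     \<and> (\<forall>x\<in>carrier G. \<forall>y\<in>carrier G. \<forall>z\<in>carrier G.
           mbeta G f (mbeta G f x y) z = \<one>\<^bsub>G\<^esub>)
     \<and> (\<forall>x\<in>carrier G. \<forall>y\<in>carrier G.
           mbeta G f (f x) (f y) = f (mbeta G f ((f ^^ 3) x) y))"

definition Iset :: "int \<Rightarrow> int \<Rightarrow> int set" where
  "Iset i j = (if i = j then {} else if i < j then {i..j - 1} else {j..i - 1})"

end

(* Write x +_n y = f^n (f^-n x + f^-n y). As T_a is a pseudoautomorphism with companion a^3,
   x (y a^(3n)) = (x +_n y) a^(3n), and hence
   (x a^(3n)) (y a^(3k)) = (x +_(k+2n) f^(3n) y) a^(3(n+k)).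
   The Moufang identity xu.vx = (x.uv)x with u in X a^-3 and v in X a^6 then says
   (x +_-1 y) + (z +_1 f^3 x) = x + ((y + z) +_1 f^3 x), which makes beta biadditive.
   For x, y in X the map L_x L_y L_xy^-1 is an automorphism of Q fixing X pointwise; applying it
   to a^3 z = f^3(z) a^3 shows that the values of beta lie in the radical of beta.
   Finally x +_-n y = x + y + sum of f^(-3k) beta(x,y) over k in I(0,n). *)
theory Submission
  imports Defs
begin

section \<open>Integer iterates of a permutation\<close>

text \<open>The map f is not additive, and its failure is measured twice: by \<open>\<beta>\<close>,
  the correction term of x +_-1 y, and by \<open>\<beta>'\<close>, the correction term of x +_1 y.
  The cosets X a^-3 and X a^6 are chosen because the coset product with n = -1, k = 2 has k + 2n =
  0, so that multiplying them involves plain addition. The right-hand side of the resulting identity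
  depends on y + z only; z = 0 gives \<open>\<beta> x y\<close> = \<open>\<beta>'\<close> y (f^3 x),
  and with this the identity itself becomes additivity of \<open>\<beta>\<close> in its second
  argument. The left alternative law gives f(2x) = 2f(x), that is, \<open>\<beta> x x\<close> = 0.
  Together with biadditivity this forces 2 \<open>\<beta>\<close> = 0. Hence no signs occur in the
  final sums, and I(i,j) can be a plain set, without an orientation.\<close>

lemma perm_zpow_0 [simp]: "perm_zpow S f 0 x = x"
  by (simp add: perm_zpow_def)

context
  fixes S :: "'a set" and f :: "'a \<Rightarrow> 'a"
  assumes bij: "bij_betw f S S"
begin

lemma perm_zpow_closed: "x \<in> S \<Longrightarrow> perm_zpow S f n x \<in> S"
proof -
  assume x: "x \<in> S"
  have "(f ^^ k) x \<in> S" "(inv_into S f ^^ k) x \<in> S" for k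
    using x bij by (induction k) (auto simp: bij_betw_def inv_into_into)
  then show ?thesis by (simp add: perm_zpow_def)
qed

lemma perm_zpow_plus1:
  assumes x: "x \<in> S"
  shows "perm_zpow S f (n + 1) x = f (perm_zpow S f n x)"
proof (cases "0 \<le> n")
  case True
  then show ?thesis by (simp add: perm_zpow_def nat_add_distrib)
next
  case False
  define k where "k = nat (- (n + 1))"
  have n: "n = - int (Suc k)" using False by (simp add: k_def)
  have "(inv_into S f ^^ k) x \<in> S"
    using x bij by (induction k) (auto simp: bij_betw_def inv_into_into)
  then have "f (inv_into S f ((inv_into S f ^^ k) x)) = (inv_into S f ^^ k) x"
    using bij by (simp add: bij_betw_def f_inv_into_f)
  moreover have "perm_zpow S f (n + 1) x = (inv_into S f ^^ k) x"
    by (cases k) (auto simp: perm_zpow_def n nat_add_distrib)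
  moreover have "nat (- (- int (Suc k))) = Suc k" by simp
  ultimately show ?thesis by (simp add: perm_zpow_def n del: of_nat_Suc)
qed

lemma perm_zpow_1: "x \<in> S \<Longrightarrow> perm_zpow S f 1 x = f x"
  using perm_zpow_plus1[of x 0] by simp

lemma perm_zpow_inj:
  assumes "x \<in> S" "y \<in> S" "perm_zpow S f n x = perm_zpow S f n y"
  shows "x = y"
proof -
  have inj: "inj_on f S" using bij by (simp add: bij_betw_def)
  have "perm_zpow S f n x = perm_zpow S f n y \<longrightarrow> x = y"
  proof (induction n rule: int_induct[where k=0])
    case base then show ?case by simp
  next
    case (step1 i)
    then show ?case using assms(1,2) inj
      by (simp add: perm_zpow_plus1 perm_zpow_closed inj_on_eq_iff)
  next
    case (step2 i)
    then show ?case using perm_zpow_plus1[of x "i - 1"] perm_zpow_plus1[of y "i - 1"] assms(1,2)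
      by simp
  qed
  then show ?thesis using assms by simp
qed

lemma perm_zpow_zpow:
  assumes x: "x \<in> S"
  shows "perm_zpow S f n (perm_zpow S f k x) = perm_zpow S f (n + k) x"
proof (induction n rule: int_induct[where k=0])
  case base then show ?case by simp
next
  case (step1 i)
  have "i + 1 + k = (i + k) + 1" by simp
  then show ?case using step1 x perm_zpow_plus1 perm_zpow_closed by metis
next
  case (step2 i)
  have "f (perm_zpow S f (i - 1) (perm_zpow S f k x)) = f (perm_zpow S f (i - 1 + k) x)"
    using step2 perm_zpow_plus1[of "perm_zpow S f k x" "i - 1"] perm_zpow_plus1[of x "i - 1 + k"] x
    by (simp add: perm_zpow_closed algebra_simps)
  then show ?case using bij x by (auto simp: bij_betw_def inj_on_eq_iff perm_zpow_closed)
qed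

lemma perm_zpow_minus1: "x \<in> S \<Longrightarrow> perm_zpow S f (-1) x = inv_into S f x"
  by (simp add: perm_zpow_def)

lemma perm_zpow_3: "x \<in> S \<Longrightarrow> perm_zpow S f 3 x = (f ^^ 3) x"
  by (simp add: perm_zpow_def)

end

lemma Iset_commute: "Iset i j = Iset j i"
  by (auto simp: Iset_def)

lemma Iset_shift: "(\<lambda>k. k + d) ` Iset i j = Iset (i + d) (j + d)"
  by (simp add: Iset_def algebra_simps)

section \<open>Moufang permutations\<close>

text \<open>Only bijectivity is assumed, since the Moufang property has to be derived
  (\<open>moufang_permI\<close>) before \<open>moufang_perm_group\<close> can assume it.\<close>

locale perm_of_comm_group = comm_group G for G (structure) +
  fixes f :: "'a \<Rightarrow> 'a"
  assumes bij: "bij_betw f (carrier G) (carrier G)"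
begin

abbreviation F :: "int \<Rightarrow> 'a \<Rightarrow> 'a" where "F n \<equiv> perm_zpow (carrier G) f n"
abbreviation \<beta> :: "'a \<Rightarrow> 'a \<Rightarrow> 'a" where "\<beta> \<equiv> mbeta G f"

lemmas F_closed [simp] = perm_zpow_closed[OF bij]
lemmas F_F [simp] = perm_zpow_zpow[OF bij]
lemmas F_inj = perm_zpow_inj[OF bij]
lemmas f_eq_F = perm_zpow_1[OF bij, symmetric]

lemma F_eq_iff [simp]:
  "\<lbrakk>x \<in> carrier G; y \<in> carrier G\<rbrakk> \<Longrightarrow> F n x = F n y \<longleftrightarrow> x = y"
  using F_inj by blast

lemma mbeta_eq:
  "\<lbrakk>x \<in> carrier G; y \<in> carrier G\<rbrakk> \<Longrightarrow> \<beta> x y = F (-1) (F 1 x \<otimes> F 1 y) \<otimes> inv x \<otimes> inv y"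
  by (simp add: mbeta_def f_eq_F perm_zpow_minus1[OF bij])

lemma mbeta_closed [simp]: "\<lbrakk>x \<in> carrier G; y \<in> carrier G\<rbrakk> \<Longrightarrow> \<beta> x y \<in> carrier G"
  by (simp add: mbeta_eq)

lemma m_inv_cancel:
  assumes "x \<in> carrier G" "y \<in> carrier G" "w \<in> carrier G"
  shows "x \<otimes> y \<otimes> (w \<otimes> inv x \<otimes> inv y) = w"
proof -
  have "x \<otimes> y \<otimes> (w \<otimes> inv x \<otimes> inv y) = w \<otimes> (x \<otimes> inv x) \<otimes> (y \<otimes> inv y)"
    using assms by (simp add: m_ac del: r_inv Units_r_inv)
  then show ?thesis using assms by simp
qed

lemma F_mbeta:
  "\<lbrakk>x \<in> carrier G; y \<in> carrier G\<rbrakk> \<Longrightarrow> F (-1) (F 1 x \<otimes> F 1 y) = x \<otimes> y \<otimes> \<beta> x y"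
  by (simp add: mbeta_eq m_inv_cancel)

lemma mbeta_sym: "\<lbrakk>x \<in> carrier G; y \<in> carrier G\<rbrakk> \<Longrightarrow> \<beta> x y = \<beta> y x"
  by (simp add: mbeta_eq m_ac)

lemma moufang_perm_iff:
  "moufang_perm G f \<longleftrightarrow>
     (\<forall>x\<in>carrier G. \<beta> x x = \<one>)
     \<and> (\<forall>x\<in>carrier G. \<forall>y\<in>carrier G. \<forall>z\<in>carrier G. \<beta> (x \<otimes> y) z = \<beta> x z \<otimes> \<beta> y z)
     \<and> (\<forall>x\<in>carrier G. \<forall>y\<in>carrier G. \<forall>z\<in>carrier G. \<beta> (\<beta> x y) z = \<one>)
     \<and> (\<forall>x\<in>carrier G. \<forall>y\<in>carrier G. \<beta> (F 1 x) (F 1 y) = F 1 (\<beta> (F 3 x) y))"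
proof -
  have "(\<forall>x\<in>carrier G. \<forall>y\<in>carrier G. \<beta> (f x) (f y) = f (\<beta> ((f ^^ 3) x) y)) \<longleftrightarrow>
    (\<forall>x\<in>carrier G. \<forall>y\<in>carrier G. \<beta> (F 1 x) (F 1 y) = F 1 (\<beta> (F 3 x) y))"
    by (intro ball_cong refl)
       (metis F_closed f_eq_F mbeta_closed perm_zpow_3[OF bij])
  moreover have "(\<forall>x\<in>carrier G. \<forall>y\<in>carrier G. \<forall>z\<in>carrier G.
        \<beta> (x \<otimes> y) z = \<beta> x z \<otimes> \<beta> y z \<and> \<beta> x (y \<otimes> z) = \<beta> x y \<otimes> \<beta> x z) \<longleftrightarrow>
     (\<forall>x\<in>carrier G. \<forall>y\<in>carrier G. \<forall>z\<in>carrier G. \<beta> (x \<otimes> y) z = \<beta> x z \<otimes> \<beta> y z)"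
    using mbeta_sym by (metis m_closed)
  ultimately show ?thesis
    unfolding moufang_perm_def using bij mbeta_sym by auto
qed

text \<open>The interface to loops: no hypothesis mentions \<open>\<beta>\<close>, so each can be
  read off from a loop identity. \<open>square\<close> yields the alternating law,
  \<open>shift\<close> biadditivity, \<open>rad\<close> the radical condition; the element c in
  \<open>rad\<close> is a value of \<open>\<beta>\<close> in disguise.\<close>

lemma moufang_permI:
  assumes square: "\<And>x. x \<in> carrier G \<Longrightarrow> F 1 (x \<otimes> x) = F 1 x \<otimes> F 1 x"
    and shift: "\<And>x y z. \<lbrakk>x \<in> carrier G; y \<in> carrier G; z \<in> carrier G\<rbrakk> \<Longrightarrow>
      F (-1) (F 1 x \<otimes> F 1 y) \<otimes> F 1 (F (-1) z \<otimes> F 2 x)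
        = x \<otimes> F 1 (F (-1) (y \<otimes> z) \<otimes> F 2 x)"
    and rad: "\<And>x y v c. \<lbrakk>x \<in> carrier G; y \<in> carrier G; v \<in> carrier G;
      c = F (-1) x \<otimes> F (-1) y \<otimes> F (-1) (inv (x \<otimes> y))\<rbrakk> \<Longrightarrow>
      F 1 (F (-1) c \<otimes> F (-1) v) = c \<otimes> v"
  shows "moufang_perm G f"
proof -
  define \<beta>' where "\<beta>' x y = F 1 (F (-1) x \<otimes> F (-1) y) \<otimes> inv x \<otimes> inv y" for x y
  have \<beta>'_closed [simp]: "\<beta>' x y \<in> carrier G" if "x \<in> carrier G" "y \<in> carrier G" for x y
    using that by (simp add: \<beta>'_def)
  have F_\<beta>': "F 1 (F (-1) x \<otimes> F (-1) y) = x \<otimes> y \<otimes> \<beta>' x y"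
    if "x \<in> carrier G" "y \<in> carrier G" for x y
    using that by (simp add: \<beta>'_def m_inv_cancel)
  have F1_one: "F 1 \<one> = \<one>"
    using square[of \<one>] l_cancel_one[of "F 1 \<one>" "F 1 \<one>"] by simp
  have Fm1_one: "F (-1) \<one> = \<one>"
    using F_F[of \<one> "-1" 1] F1_one by simp
  have cocycle: "\<beta> x y \<otimes> \<beta>' z (F 3 x) = \<beta>' (y \<otimes> z) (F 3 x)"
    if [simp]: "x \<in> carrier G" "y \<in> carrier G" "z \<in> carrier G" for x y z
  proof -
    have "F 1 (F (-1) u \<otimes> F 2 x) = u \<otimes> F 3 x \<otimes> \<beta>' u (F 3 x)" if "u \<in> carrier G" for u
      using F_\<beta>'[of u "F 3 x"] that by simp
    then have "(x \<otimes> y \<otimes> \<beta> x y) \<otimes> (z \<otimes> F 3 x \<otimes> \<beta>' z (F 3 x))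
        = x \<otimes> (y \<otimes> z \<otimes> F 3 x \<otimes> \<beta>' (y \<otimes> z) (F 3 x))"
      using shift[of x y z] by (simp add: F_mbeta)
    moreover have "(x \<otimes> y \<otimes> \<beta> x y) \<otimes> (z \<otimes> F 3 x \<otimes> \<beta>' z (F 3 x))
        = (x \<otimes> y \<otimes> z \<otimes> F 3 x) \<otimes> (\<beta> x y \<otimes> \<beta>' z (F 3 x))"
      by (simp add: m_ac)
    moreover have "x \<otimes> (y \<otimes> z \<otimes> F 3 x \<otimes> \<beta>' (y \<otimes> z) (F 3 x))
        = (x \<otimes> y \<otimes> z \<otimes> F 3 x) \<otimes> \<beta>' (y \<otimes> z) (F 3 x)"
      by (simp add: m_ac)
    ultimately show ?thesis by simp
  qed
  \<comment> \<open>Since f fixes the identity, \<open>\<beta>' \<one> w\<close> vanishes.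
    Substituting the result back into \<open>cocycle\<close> gives \<open>add\<close>.\<close>
  have \<beta>_\<beta>': "\<beta> x y = \<beta>' y (F 3 x)" if [simp]: "x \<in> carrier G" "y \<in> carrier G" for x y
    using cocycle[of x y \<one>] by (simp add: \<beta>'_def Fm1_one)
  have add: "\<beta> x (y \<otimes> z) = \<beta> x y \<otimes> \<beta> x z"
    if "x \<in> carrier G" "y \<in> carrier G" "z \<in> carrier G" for x y z
    using cocycle[of x y z] that by (simp add: \<beta>_\<beta>')
  have add': "\<beta> (x \<otimes> y) z = \<beta> x z \<otimes> \<beta> y z"
    if "x \<in> carrier G" "y \<in> carrier G" "z \<in> carrier G" for x y z
    using add[of z x y] that by (simp add: mbeta_sym)
  have one: "\<beta> x \<one> = \<one>" if "x \<in> carrier G" for x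
    using that by (simp add: mbeta_eq F1_one)
  have alt: "\<beta> x x = \<one>" if [simp]: "x \<in> carrier G" for x
  proof -
    have "x \<otimes> x \<otimes> \<beta> x x = x \<otimes> x \<otimes> \<one>"
      using square[of x] F_mbeta[of x x] by (simp flip: square)
    then show ?thesis by (simp del: r_one)
  qed
  have inv_right: "\<beta> x (inv y) = inv (\<beta> x y)" if [simp]: "x \<in> carrier G" "y \<in> carrier G" for x y
  proof -
    have "\<beta> x (inv y) \<otimes> \<beta> x y = \<one>"
      using add[of x "inv y" y] by (simp add: one)
    then show ?thesis by (simp add: inv_equality)
  qed
  have exp2: "\<beta> x y \<otimes> \<beta> x y = \<one>" if [simp]: "x \<in> carrier G" "y \<in> carrier G" for x y
  proof -
    have "\<beta> (x \<otimes> y) (x \<otimes> y) = \<beta> x y \<otimes> \<beta> x y"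
      by (simp add: add add' alt[of x] alt[of y] mbeta_sym[of y x])
    then show ?thesis using alt[OF m_closed[OF that]] by metis
  qed
  \<comment> \<open>Inversion commutes with f because \<open>\<beta> (inv u) u\<close> is the
    inverse of \<open>\<beta> u u\<close> and hence trivial. This is what identifies c in
    \<open>rad\<close>.\<close>
  have F_inv: "F (-1) (inv x) = inv (F (-1) x)" if [simp]: "x \<in> carrier G" for x
  proof -
    define u where "u = F (-1) x"
    have [simp]: "u \<in> carrier G" and x: "x = F 1 u" by (simp_all add: u_def)
    have "F (-1) (F 1 (inv u) \<otimes> F 1 u) = F (-1) \<one>"
      using F_mbeta[of "inv u" u] mbeta_sym[of "inv u" u] by (simp add: inv_right alt Fm1_one)
    then have "F 1 (inv u) \<otimes> F 1 u = \<one>" by simp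
    then have "F 1 (inv u) = inv (F 1 u)" by (simp add: inv_equality)
    then show ?thesis using F_F[of "inv u" "-1" 1] by (simp add: x)
  qed
  have rad_right: "\<beta> z (\<beta> x y) = \<one>"
    if [simp]: "x \<in> carrier G" "y \<in> carrier G" "z \<in> carrier G" for x y z
  proof -
    have "F (-1) (inv (F 1 x \<otimes> F 1 y)) = inv (x \<otimes> y \<otimes> \<beta> x y)"
      by (simp add: F_inv F_mbeta del: inv_mult)
    also have "\<dots> = inv (\<beta> x y) \<otimes> inv x \<otimes> inv y" by (simp add: inv_mult m_ac)
    finally have "F (-1) (F 1 x) \<otimes> F (-1) (F 1 y) \<otimes> F (-1) (inv (F 1 x \<otimes> F 1 y)) = inv (\<beta> x y)"
      by (simp add: m_inv_cancel)
    \<comment> \<open>The choice v = \<open>F 3 z\<close> lets \<open>\<beta>_\<beta>'\<close>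
      translate the outcome back to \<open>\<beta> z\<close>.\<close>
    then have "F 1 (F (-1) (inv (\<beta> x y)) \<otimes> F (-1) (F 3 z)) = inv (\<beta> x y) \<otimes> F 3 z"
      using rad[of "F 1 x" "F 1 y" "F 3 z" "inv (\<beta> x y)"] by simp
    then have "\<beta>' (inv (\<beta> x y)) (F 3 z) = \<one>"
      using F_\<beta>'[of "inv (\<beta> x y)" "F 3 z"] r_cancel_one'[of "inv (\<beta> x y) \<otimes> F 3 z"]
      by simp
    then have "inv (\<beta> z (\<beta> x y)) = \<one>"
      by (simp add: inv_right flip: \<beta>_\<beta>')
    then show ?thesis by (metis inv_inv inv_one mbeta_closed that)
  qed
  have twist: "\<beta> (F 1 x) (F 1 y) = F 1 (\<beta> (F 3 x) y)"
    if [simp]: "x \<in> carrier G" "y \<in> carrier G" for x y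
  proof -
    define w where "w = F 3 x"
    have [simp]: "w \<in> carrier G" by (simp add: w_def)
    \<comment> \<open>f is additive on a sum with one summand in the radical of
      \<open>\<beta>\<close>.\<close>
    have F_rad: "F 1 (u \<otimes> \<beta> y w) = F 1 u \<otimes> F 1 (\<beta> y w)" if "u \<in> carrier G" for u
      using F_mbeta[of u "\<beta> y w"] F_F[of "F 1 u \<otimes> F 1 (\<beta> y w)" 1 "-1"] that
      by (simp add: rad_right)
    have "F 1 y \<otimes> F 1 w = F 1 (y \<otimes> w \<otimes> \<beta> y w)"
      using F_F[of "F 1 y \<otimes> F 1 w" 1 "-1"] by (simp add: F_mbeta)
    also have "\<dots> = F 1 (y \<otimes> w) \<otimes> F 1 (\<beta> y w)" by (simp add: F_rad)
    also have "F 1 (y \<otimes> w) = F 1 y \<otimes> F 1 w \<otimes> \<beta>' (F 1 y) (F 1 w)"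
      using F_\<beta>'[of "F 1 y" "F 1 w"] by simp
    finally have "\<beta>' (F 1 y) (F 1 w) \<otimes> F 1 (\<beta> y w) = \<one>"
      by (simp add: m_assoc)
    \<comment> \<open>Passing from +_1 to +_-1 inverts the correction term; exponent 2 makes the
      inversion invisible.\<close>
    moreover have "F 1 (\<beta> y w) \<otimes> F 1 (\<beta> y w) = \<one>"
      using square[of "\<beta> y w"] by (simp add: exp2 F1_one)
    ultimately have "\<beta>' (F 1 y) (F 1 w) = F 1 (\<beta> y w)"
      by (metis F_closed \<beta>'_closed mbeta_closed right_cancel \<open>w \<in> carrier G\<close> that(2))
    then show ?thesis by (simp add: \<beta>_\<beta>'[of "F 1 x"] w_def mbeta_sym[of _ y])
  qed
  show ?thesis
    unfolding moufang_perm_iff using alt add' rad_right twist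
    by (simp add: mbeta_sym[of "\<beta> _ _"])
qed

end

section \<open>The sum formula for Moufang permutations\<close>

locale moufang_perm_group = perm_of_comm_group +
  assumes moufang: "moufang_perm G f"
begin

lemma mbeta_self: "x \<in> carrier G \<Longrightarrow> \<beta> x x = \<one>"
  using moufang by (simp add: moufang_perm_def)

lemma mbeta_mult:
  assumes "x \<in> carrier G" "y \<in> carrier G" "z \<in> carrier G"
  shows "\<beta> (x \<otimes> y) z = \<beta> x z \<otimes> \<beta> y z" "\<beta> x (y \<otimes> z) = \<beta> x y \<otimes> \<beta> x z"
  using moufang assms by (simp_all add: moufang_perm_def)

lemma mbeta_mbeta:
  assumes "x \<in> carrier G" "y \<in> carrier G" "z \<in> carrier G"
  shows "\<beta> z (\<beta> x y) = \<one>"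
  using moufang assms mbeta_sym by (simp add: moufang_perm_def)

lemma mbeta_F1: "\<lbrakk>x \<in> carrier G; y \<in> carrier G\<rbrakk> \<Longrightarrow> \<beta> (F 1 x) (F 1 y) = F 1 (\<beta> (F 3 x) y)"
  using moufang by (simp add: moufang_perm_iff)

lemma mbeta_mult_self:
  assumes [simp]: "x \<in> carrier G" "y \<in> carrier G"
  shows "\<beta> x y \<otimes> \<beta> x y = \<one>"
proof -
  have "\<beta> (x \<otimes> y) (x \<otimes> y) = \<beta> x y \<otimes> \<beta> x y"
    by (simp add: mbeta_mult mbeta_self[of x] mbeta_self[of y] mbeta_sym[of y x])
  then show ?thesis using mbeta_self[OF m_closed[OF assms]] by metis
qed

text \<open>By \<open>mbeta_F1\<close>, absorbing an outer \<open>F 1\<close> changes the exponents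
  (r, s) of f on the two arguments to (r - 2, s + 1). Three such steps lead from (9, 0) to (3, 3),
  and since \<open>F 3\<close> may change sides by symmetry, to (6, 0).\<close>

lemma mbeta_F3:
  assumes [simp]: "x \<in> carrier G" "y \<in> carrier G"
  shows "\<beta> (F 3 x) y = F (-3) (\<beta> x y)"
proof -
  \<comment> \<open>Writing x as \<open>F 6 x'\<close> keeps all exponents in the chain
    nonnegative.\<close>
  define x' where "x' = F (-6) x"
  have x: "x = F 6 x'" and [simp]: "x' \<in> carrier G" by (simp_all add: x'_def)
  have move: "\<beta> (F 3 u) v = \<beta> u (F 3 v)" if [simp]: "u \<in> carrier G" "v \<in> carrier G" for u v
  proof -
    have "F 1 (\<beta> (F 3 u) v) = F 1 (\<beta> (F 3 v) u)"
      using mbeta_F1[of u v] mbeta_F1[of v u] mbeta_sym[of "F 1 u" "F 1 v"] by simp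
    then show ?thesis by (simp add: mbeta_sym[of "F 3 v" u])
  qed
  have "F 3 (\<beta> (F 9 x') y) = F 2 (F 1 (\<beta> (F 3 (F 6 x')) y))"
    by simp
  also have "\<dots> = F 2 (\<beta> (F 1 (F 6 x')) (F 1 y))"
    by (subst mbeta_F1) simp_all
  also have "\<dots> = F 1 (F 1 (\<beta> (F 3 (F 4 x')) (F 1 y)))"
    by simp
  also have "\<dots> = F 1 (\<beta> (F 1 (F 4 x')) (F 1 (F 1 y)))"
    by (subst mbeta_F1) simp_all
  also have "\<dots> = F 1 (\<beta> (F 3 (F 2 x')) (F 2 y))"
    by simp
  also have "\<dots> = \<beta> (F 1 (F 2 x')) (F 1 (F 2 y))"
    by (subst mbeta_F1) simp_all
  also have "\<dots> = \<beta> (F 3 x') (F 3 y)"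
    by simp
  also have "\<dots> = \<beta> (F 6 x') y"
    using move[of "F 3 x'" y] by simp
  finally have "F 3 (\<beta> (F 3 x) y) = \<beta> x y" by (simp add: x)
  then show ?thesis using F_F[of "\<beta> (F 3 x) y" "-3" 3] by simp
qed

lemma mbeta_F3n:
  assumes [simp]: "x \<in> carrier G" "y \<in> carrier G"
  shows "\<beta> (F (3 * n) x) y = F (- 3 * n) (\<beta> x y)"
proof (induction n rule: int_induct[where k=0])
  case base then show ?case by simp
next
  case (step1 i)
  have "\<beta> (F (3 * (i + 1)) x) y = \<beta> (F 3 (F (3 * i) x)) y" by (simp add: algebra_simps)
  also have "\<dots> = F (-3) (\<beta> (F (3 * i) x) y)" by (simp only: mbeta_F3 F_closed assms)
  finally show ?case using step1 by (simp add: algebra_simps)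
next
  case (step2 i)
  have "\<beta> (F (3 * i) x) y = \<beta> (F 3 (F (3 * (i - 1)) x)) y" by (simp add: algebra_simps)
  also have "\<dots> = F (-3) (\<beta> (F (3 * (i - 1)) x) y)" by (simp only: mbeta_F3 F_closed assms)
  finally have "F 3 (\<beta> (F (3 * i) x) y) = F 3 (F (-3) (\<beta> (F (3 * (i - 1)) x) y))" by simp
  then show ?case using step2 by (simp add: algebra_simps)
qed

lemma mbeta_F_F:
  assumes [simp]: "x \<in> carrier G" "y \<in> carrier G"
  shows "\<beta> (F n x) (F n y) = F (- 2 * n) (\<beta> x y)"
proof -
  have one: "\<beta> (F 1 u) (F 1 v) = F (-2) (\<beta> u v)" if "u \<in> carrier G" "v \<in> carrier G" for u v
    using that by (simp add: mbeta_F1 mbeta_F3)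
  show ?thesis
  proof (induction n rule: int_induct[where k=0])
    case base then show ?case by simp
  next
    case (step1 i)
    then show ?case using one[of "F i x" "F i y"] by (simp add: algebra_simps)
  next
    case (step2 i)
    then have "F 2 (F (- 2 * i) (\<beta> x y)) = F 2 (F (-2) (\<beta> (F (i - 1) x) (F (i - 1) y)))"
      using one[of "F (i - 1) x" "F (i - 1) y"] by simp
    then show ?case by (simp add: algebra_simps)
  qed
qed

text \<open>Powers of f map values of \<open>\<beta>\<close> to values of \<open>\<beta>\<close>, so
  exponent 2 and membership in the radical carry over to every
  \<open>F n (\<beta> x y)\<close>.\<close>

lemma F_mbeta_eq_mbeta:
  assumes [simp]: "x \<in> carrier G" "y \<in> carrier G"
  shows "F n (\<beta> x y) = \<beta> (F (- 2 * n) x) (F n y)"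
proof -
  have "\<beta> (F n (F (3 * (- n)) x)) (F n y) = F (- 2 * n) (\<beta> (F (3 * (- n)) x) y)"
    by (simp only: mbeta_F_F F_closed assms)
  also have "\<dots> = F (- 2 * n) (F (- 3 * (- n)) (\<beta> x y))"
    by (simp only: mbeta_F3n assms)
  finally show ?thesis by (simp add: algebra_simps)
qed

lemma F_mult_mbeta:
  assumes [simp]: "u \<in> carrier G" "x \<in> carrier G" "y \<in> carrier G"
  shows "F n (u \<otimes> \<beta> x y) = F n u \<otimes> F n (\<beta> x y)"
proof -
  have one: "F 1 (v \<otimes> F k (\<beta> x y)) = F 1 v \<otimes> F 1 (F k (\<beta> x y))"
    if [simp]: "v \<in> carrier G" for v k
  proof -
    have "\<beta> v (F k (\<beta> x y)) = \<one>"
      by (subst F_mbeta_eq_mbeta) (simp_all add: mbeta_mbeta)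
    then have "F (-1) (F 1 v \<otimes> F 1 (F k (\<beta> x y))) = v \<otimes> F k (\<beta> x y)"
      by (subst F_mbeta) simp_all
    then show ?thesis using F_F[of "F 1 v \<otimes> F 1 (F k (\<beta> x y))" 1 "-1"] by simp
  qed
  show ?thesis
  proof (induction n rule: int_induct[where k=0])
    case base then show ?case by simp
  next
    case (step1 i)
    then show ?case using one[of "F i u" i] F_F[of "u \<otimes> \<beta> x y" 1 i] by (simp add: algebra_simps)
  next
    case (step2 i)
    then have "F 1 (F (i - 1) (u \<otimes> \<beta> x y)) = F 1 (F (i - 1) u \<otimes> F (i - 1) (\<beta> x y))"
      using one[of "F (i - 1) u" "i - 1"] by simp
    then show ?case by (simp only: F_eq_iff F_closed m_closed mbeta_closed assms)
  qed
qed

text \<open>The new correction \<open>\<beta> (F n x) (F n y)\<close> equals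
  \<open>F (- 2 * n) (\<beta> x y)\<close>; pulling it back by \<open>F (- n)\<close> produces the
  exponent -3n.\<close>

lemma F_conj_step:
  assumes [simp]: "x \<in> carrier G" "y \<in> carrier G"
  shows "F (- (n + 1)) (F (n + 1) x \<otimes> F (n + 1) y)
    = F (- n) (F n x \<otimes> F n y) \<otimes> F (- 3 * n) (\<beta> x y)"
proof -
  have "F (- (n + 1)) (F (n + 1) x \<otimes> F (n + 1) y)
      = F (- n) (F (-1) (F 1 (F n x) \<otimes> F 1 (F n y)))"
    by (simp add: algebra_simps)
  also have "\<dots> = F (- n) (F n x \<otimes> F n y \<otimes> \<beta> (F n x) (F n y))"
    by (simp only: F_mbeta F_closed assms)
  also have "\<dots> = F (- n) (F n x \<otimes> F n y) \<otimes> F (- n) (\<beta> (F n x) (F n y))"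
    by (simp add: F_mult_mbeta)
  also have "F (- n) (\<beta> (F n x) (F n y)) = F (- 3 * n) (\<beta> x y)"
    by (simp add: mbeta_F_F)
  finally show ?thesis .
qed

lemma finprod_shift_int:
  fixes A :: "int set"
  assumes "\<And>k. h k \<in> carrier G"
  shows "(\<Otimes>k\<in>(\<lambda>k. k + d) ` A. h k) = (\<Otimes>k\<in>A. h (k + d))"
  using assms by (intro finprod_reindex) auto

lemma F_conj_eq:
  assumes [simp]: "x \<in> carrier G" "y \<in> carrier G"
  shows "F (- n) (F n x \<otimes> F n y) = x \<otimes> y \<otimes> (\<Otimes>k\<in>Iset 0 n. F (- 3 * k) (\<beta> x y))"
proof (induction n rule: int_induct[where k=0])
  case base then show ?case by (simp add: Iset_def)
next
  case (step1 i)
  have "Iset 0 (i + 1) = insert i (Iset 0 i)" "i \<notin> Iset 0 i" "finite (Iset 0 i)"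
    using step1(1) by (auto simp: Iset_def)
  then show ?case using F_conj_step[of x y i] step1 by (simp add: m_ac)
next
  case (step2 i)
  let ?b = "F (- 3 * (i - 1)) (\<beta> x y)" and ?u = "F (- (i - 1)) (F (i - 1) x \<otimes> F (i - 1) y)"
  have "Iset 0 (i - 1) = insert (i - 1) (Iset 0 i)" "i - 1 \<notin> Iset 0 i" "finite (Iset 0 i)"
    using step2(1) by (auto simp: Iset_def)
  then have I: "(\<Otimes>k\<in>Iset 0 (i - 1). F (- 3 * k) (\<beta> x y))
      = ?b \<otimes> (\<Otimes>k\<in>Iset 0 i. F (- 3 * k) (\<beta> x y))"
    by simp
  \<comment> \<open>A downward step would remove the factor with index i - 1; being its own inverse,
    it is multiplied in instead.\<close>
  have bb: "?b \<otimes> ?b = \<one>"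
    by (subst (1 2) F_mbeta_eq_mbeta) (simp_all add: mbeta_mult_self)
  have "?u = ?u \<otimes> ?b \<otimes> ?b" using bb by (simp add: m_assoc)
  also have "?u \<otimes> ?b = x \<otimes> y \<otimes> (\<Otimes>k\<in>Iset 0 i. F (- 3 * k) (\<beta> x y))"
    using F_conj_step[of x y "i - 1"] step2 by simp
  finally show ?case unfolding I by (simp add: m_ac)
qed

text \<open>Replacing x by f^(-3j)(x) applies f^(3j) to \<open>\<beta> x y\<close>, which shifts the
  index set by -j. When both arguments are replaced, the factor is f^(6j) and the shift is
  -2j.\<close>

lemma F_conj_F3_left:
  assumes [simp]: "x \<in> carrier G" "y \<in> carrier G"
  shows "F (- (i + 2 * j)) (F (i + 2 * j) (F (- 3 * j) x) \<otimes> F (i + 2 * j) y)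
    = F (- 3 * j) x \<otimes> y \<otimes> (\<Otimes>k\<in>Iset (i + j) (- j). F (- 3 * k) (\<beta> x y))"
proof -
  have b: "\<beta> (F (- 3 * j) x) y = F (3 * j) (\<beta> x y)"
    using mbeta_F3n[of x y "- j"] by simp
  have I: "Iset 0 (i + 2 * j) = (\<lambda>k. k + j) ` Iset (i + j) (- j)"
    by (simp add: Iset_shift Iset_commute[of _ 0] algebra_simps)
  show ?thesis
    unfolding F_conj_eq[OF F_closed[OF assms(1)] assms(2)] b I
    by (subst finprod_shift_int) (simp_all add: algebra_simps)
qed

lemma F_conj_F3_both:
  assumes [simp]: "x \<in> carrier G" "y \<in> carrier G"
  shows "F (- (i + 2 * j)) (F (i + 2 * j) (F (- 3 * j) x) \<otimes> F (i + 2 * j) (F (- 3 * j) y))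
    = F (- 3 * j) x \<otimes> F (- 3 * j) y \<otimes> (\<Otimes>k\<in>Iset (- 2 * j) i. F (- 3 * k) (\<beta> x y))"
proof -
  have b: "\<beta> (F (- 3 * j) x) (F (- 3 * j) y) = F (6 * j) (\<beta> x y)"
    using mbeta_F_F[of x y "- 3 * j"] by simp
  have I: "Iset 0 (i + 2 * j) = (\<lambda>k. k + 2 * j) ` Iset (- 2 * j) i"
    by (simp add: Iset_shift algebra_simps)
  show ?thesis
    unfolding F_conj_eq[OF F_closed[OF assms(1)] F_closed[OF assms(2)]] b I
    by (subst finprod_shift_int) (simp_all add: algebra_simps)
qed

end

section \<open>Moufang loops\<close>

locale moufang =
  fixes Q :: "'a set" and m :: "'a \<Rightarrow> 'a \<Rightarrow> 'a" (infixl "\<cdot>" 70) and e :: 'a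
  assumes moufang_loop: "moufang_loop Q m e"
begin

lemma is_loop: "is_loop Q m e"
  using moufang_loop by (simp add: moufang_loop_def)

lemma e_closed [simp]: "e \<in> Q"
  using is_loop by (simp add: is_loop_def)

lemma closed [simp]: "\<lbrakk>x \<in> Q; y \<in> Q\<rbrakk> \<Longrightarrow> x \<cdot> y \<in> Q"
  using is_loop by (simp add: is_loop_def)

lemma e_left [simp]: "x \<in> Q \<Longrightarrow> e \<cdot> x = x"
  and e_right [simp]: "x \<in> Q \<Longrightarrow> x \<cdot> e = x"
  using is_loop by (simp_all add: is_loop_def)

lemma ex1_right: "\<lbrakk>x \<in> Q; y \<in> Q\<rbrakk> \<Longrightarrow> \<exists>!z. z \<in> Q \<and> x \<cdot> z = y"
  using is_loop by (simp add: is_loop_def)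

lemma ex1_left: "\<lbrakk>x \<in> Q; y \<in> Q\<rbrakk> \<Longrightarrow> \<exists>!z. z \<in> Q \<and> z \<cdot> x = y"
  using is_loop by (simp add: is_loop_def)

lemma middle: "\<lbrakk>x \<in> Q; y \<in> Q; z \<in> Q\<rbrakk> \<Longrightarrow> (x \<cdot> y) \<cdot> (z \<cdot> x) = x \<cdot> (y \<cdot> z) \<cdot> x"
  using moufang_loop by (simp add: moufang_loop_def)

lemma left_cancel [simp]:
  assumes "x \<in> Q" "y \<in> Q" "z \<in> Q"
  shows "x \<cdot> y = x \<cdot> z \<longleftrightarrow> y = z"
proof
  assume "x \<cdot> y = x \<cdot> z"
  then show "y = z" using ex1_right[of x "x \<cdot> z"] assms closed[of x z] by blast
qed simp

lemma right_cancel [simp]: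
  assumes "x \<in> Q" "y \<in> Q" "z \<in> Q"
  shows "y \<cdot> x = z \<cdot> x \<longleftrightarrow> y = z"
proof
  assume "y \<cdot> x = z \<cdot> x"
  then show "y = z" using ex1_left[of x "z \<cdot> x"] assms closed[of z x] by blast
qed simp

abbreviation J :: "'a \<Rightarrow> 'a" where "J \<equiv> linv Q m e"

lemma linv_props: "x \<in> Q \<Longrightarrow> J x \<in> Q \<and> x \<cdot> J x = e"
  unfolding linv_def using theI'[OF ex1_right[of x e]] by simp

lemma linv_closed [simp]: "x \<in> Q \<Longrightarrow> J x \<in> Q"
  and linv_right [simp]: "x \<in> Q \<Longrightarrow> x \<cdot> J x = e"
  using linv_props by auto

lemma flexible: "\<lbrakk>x \<in> Q; z \<in> Q\<rbrakk> \<Longrightarrow> x \<cdot> (z \<cdot> x) = x \<cdot> z \<cdot> x"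
  using middle[of x e z] by simp

lemma left_inverse_cancel [simp]:
  assumes [simp]: "x \<in> Q" "z \<in> Q"
  shows "x \<cdot> (J x \<cdot> z) = z" "J x \<cdot> (x \<cdot> z) = z"
proof -
  have *: "x \<cdot> (J x \<cdot> w) = w" if [simp]: "w \<in> Q" for w
    using middle[of x "J x" w] by simp
  show "x \<cdot> (J x \<cdot> z) = z" by (simp add: *)
  show "J x \<cdot> (x \<cdot> z) = z" using *[of "x \<cdot> z"] by simp
qed

lemma linv_left [simp]: "x \<in> Q \<Longrightarrow> J x \<cdot> x = e"
  using left_inverse_cancel(2)[of x e] by simp

lemma linv_linv [simp]: "x \<in> Q \<Longrightarrow> J (J x) = x"
  using left_cancel[of "J x" "J (J x)" x] by (simp del: left_cancel)

lemma right_inverse_cancel [simp]: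
  assumes [simp]: "x \<in> Q" "z \<in> Q"
  shows "z \<cdot> J x \<cdot> x = z" "z \<cdot> x \<cdot> J x = z"
proof -
  have *: "w \<cdot> J y \<cdot> y = w" if [simp]: "w \<in> Q" "y \<in> Q" for w y
  proof -
    have "y \<cdot> w = y \<cdot> (w \<cdot> J y) \<cdot> y" using middle[of y w "J y"] by simp
    also have "\<dots> = y \<cdot> (w \<cdot> J y \<cdot> y)" by (simp add: flexible)
    finally show ?thesis by simp
  qed
  show "z \<cdot> J x \<cdot> x = z" by (simp add: *)
  show "z \<cdot> x \<cdot> J x = z" using *[of z "J x"] by simp
qed

lemma linv_mult:
  assumes [simp]: "x \<in> Q" "y \<in> Q"
  shows "J (x \<cdot> y) = J y \<cdot> J x"
proof -
  have "J x \<cdot> (x \<cdot> y) \<cdot> J (x \<cdot> y) = J x" by (rule right_inverse_cancel) simp_all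
  then have "y \<cdot> J (x \<cdot> y) = J x" by simp
  moreover have "J y \<cdot> (y \<cdot> J (x \<cdot> y)) = J (x \<cdot> y)" by (rule left_inverse_cancel) simp_all
  ultimately show ?thesis by (simp only:)
qed

section \<open>Moufang autotopisms and the right Bol identity\<close>

lemma left_autotopism:
  assumes [simp]: "x \<in> Q" "u \<in> Q" "v \<in> Q"
  shows "(x \<cdot> u \<cdot> x) \<cdot> (J x \<cdot> v) = x \<cdot> (u \<cdot> v)"
proof -
  have "x \<cdot> u \<cdot> x = x \<cdot> (u \<cdot> v \<cdot> J v) \<cdot> x" by simp
  also have "\<dots> = (x \<cdot> (u \<cdot> v)) \<cdot> (J v \<cdot> x)" by (rule middle[symmetric]) simp_all
  also have "J v \<cdot> x = J (J x \<cdot> v)" by (simp add: linv_mult)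
  finally have "x \<cdot> u \<cdot> x = x \<cdot> (u \<cdot> v) \<cdot> J (J x \<cdot> v)" .
  moreover have "x \<cdot> (u \<cdot> v) \<cdot> J (J x \<cdot> v) \<cdot> (J x \<cdot> v) = x \<cdot> (u \<cdot> v)"
    by (rule right_inverse_cancel) simp_all
  ultimately show ?thesis by (simp only:)
qed

text \<open>Used with x = a: it transfers a factor a from the left factor of a product to the right
  one.\<close>

lemma right_bol:
  assumes [simp]: "x \<in> Q" "u \<in> Q" "v \<in> Q"
  shows "u \<cdot> x \<cdot> v \<cdot> x = u \<cdot> (x \<cdot> v \<cdot> x)"
proof -
  have "x \<cdot> v \<cdot> x = x \<cdot> (J (u \<cdot> x) \<cdot> (u \<cdot> x \<cdot> v)) \<cdot> x" by simp
  also have "\<dots> = (x \<cdot> J (u \<cdot> x)) \<cdot> (u \<cdot> x \<cdot> v \<cdot> x)" by (rule middle[symmetric]) simp_all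
  also have "x \<cdot> J (u \<cdot> x) = J u" by (simp add: linv_mult)
  finally have "u \<cdot> (x \<cdot> v \<cdot> x) = u \<cdot> (J u \<cdot> (u \<cdot> x \<cdot> v \<cdot> x))" by (simp only:)
  also have "\<dots> = u \<cdot> x \<cdot> v \<cdot> x" by (rule left_inverse_cancel) simp_all
  finally show ?thesis by (simp only:)
qed

lemma left_alternative:
  assumes [simp]: "x \<in> Q" "v \<in> Q"
  shows "x \<cdot> (x \<cdot> v) = x \<cdot> x \<cdot> v"
  using left_autotopism[of x e "x \<cdot> v"] by simp

text \<open>The three Moufang autotopisms multiply to an autotopism whose components all fix \<open>e\<close>,
  which forces these components to coincide.\<close>
lemma inner_map_hom:
  assumes [simp]: "x \<in> Q" "y \<in> Q" "u \<in> Q" "v \<in> Q"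
    and t: "t = J (x \<cdot> y)" and e: "x \<cdot> (y \<cdot> (t \<cdot> t) \<cdot> y) \<cdot> x = e" and comm: "x \<cdot> y = y \<cdot> x"
  shows "x \<cdot> (y \<cdot> (t \<cdot> (u \<cdot> v))) = (x \<cdot> (y \<cdot> (t \<cdot> u))) \<cdot> (x \<cdot> (y \<cdot> (t \<cdot> v)))"
proof -
  define A where "A u = x \<cdot> (y \<cdot> (t \<cdot> u \<cdot> t) \<cdot> y) \<cdot> x" for u
  define B where "B v = J x \<cdot> (J y \<cdot> (J t \<cdot> v))" for v
  have [simp]: "t \<in> Q" and Jt: "J t = x \<cdot> y" by (simp_all add: t)
  have [simp]: "A u \<in> Q" "B u \<in> Q" if "u \<in> Q" for u using that by (simp_all add: A_def B_def)
  have AB: "x \<cdot> (y \<cdot> (t \<cdot> (p \<cdot> q))) = A p \<cdot> B q" if [simp]: "p \<in> Q" "q \<in> Q" for p q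
  proof -
    have "t \<cdot> (p \<cdot> q) = (t \<cdot> p \<cdot> t) \<cdot> (J t \<cdot> q)"
      by (rule left_autotopism[symmetric]) simp_all
    moreover have "y \<cdot> ((t \<cdot> p \<cdot> t) \<cdot> (J t \<cdot> q)) = (y \<cdot> (t \<cdot> p \<cdot> t) \<cdot> y) \<cdot> (J y \<cdot> (J t \<cdot> q))"
      by (rule left_autotopism[symmetric]) simp_all
    moreover have "x \<cdot> ((y \<cdot> (t \<cdot> p \<cdot> t) \<cdot> y) \<cdot> (J y \<cdot> (J t \<cdot> q))) = A p \<cdot> B q"
      unfolding A_def B_def by (rule left_autotopism[symmetric]) simp_all
    ultimately show ?thesis by (simp only:)
  qed
  \<comment> \<open>Commutation of x and y enters here: the inverse of y is applied to x y before
    the inverse of x.\<close>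
  have Be: "B e = e" by (simp add: B_def Jt) (simp add: comm)
  have Ae: "A e = e" using e by (simp add: A_def)
  have A: "x \<cdot> (y \<cdot> (t \<cdot> p)) = A p" if "p \<in> Q" for p
    using AB[OF that e_closed] that by (simp only: Be e_right \<open>\<And>u. u \<in> Q \<Longrightarrow> A u \<in> Q\<close>)
  have B: "x \<cdot> (y \<cdot> (t \<cdot> p)) = B p" if "p \<in> Q" for p
    using AB[OF e_closed that] that by (simp only: Ae e_left \<open>\<And>u. u \<in> Q \<Longrightarrow> B u \<in> Q\<close>)
  show ?thesis
    by (simp only: AB[OF assms(3,4)] A[OF assms(3)] B[OF assms(4)])
qed

end

section \<open>Abelian normal subgroups of Moufang loops\<close>

locale moufang_abelian_normal = moufang +
  fixes X :: "'a set" and a :: 'a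
  assumes normal: "normal_subloop Q m e X"
    and comm_group_X: "comm_group \<lparr>carrier = X, mult = m, one = e\<rparr>"
    and a_closed [simp]: "a \<in> Q"
begin

definition f :: "'a \<Rightarrow> 'a" where "f = restrict (Tmap Q m a) X"

lemma X_subset: "x \<in> X \<Longrightarrow> x \<in> Q"
  using normal by (auto simp: normal_subloop_def)

lemma Tmap_eq: "\<lbrakk>x \<in> Q; y \<in> Q; y \<cdot> a = a \<cdot> x\<rbrakk> \<Longrightarrow> Tmap Q m a x = y"
  unfolding Tmap_def rdiv_def by (rule the_equality) (auto, metis a_closed right_cancel)

lemma coset_eq: "(\<lambda>s. a \<cdot> s) ` X = (\<lambda>s. s \<cdot> a) ` X"
  using normal a_closed unfolding normal_subloop_def by blast

lemma
  assumes x: "x \<in> X"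
  shows f_closed: "f x \<in> X" and a_left: "a \<cdot> x = f x \<cdot> a"
proof -
  obtain y where y: "y \<in> X" "a \<cdot> x = y \<cdot> a" using coset_eq x by blast
  then have "f x = y" using x by (simp add: f_def Tmap_eq X_subset)
  with y show "f x \<in> X" "a \<cdot> x = f x \<cdot> a" by simp_all
qed

lemma f_bij: "bij_betw f X X"
proof (rule bij_betw_imageI)
  show "inj_on f X"
  proof (rule inj_onI)
    fix x y assume "x \<in> X" "y \<in> X" "f x = f y"
    then show "x = y" using a_left[of x] a_left[of y] left_cancel[of a x y] by (simp add: X_subset)
  qed
  show "f ` X = X"
  proof
    show "f ` X \<subseteq> X" using f_closed by blast
    show "X \<subseteq> f ` X"
    proof
      fix y assume y: "y \<in> X"
      then obtain x where x: "x \<in> X" "y \<cdot> a = a \<cdot> x" using coset_eq by blast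
      then have "f x = y" using y right_cancel[of a "f x" y] a_left[of x] by (simp add: X_subset f_closed)
      then show "y \<in> f ` X" using x by blast
    qed
  qed
qed

interpretation X: comm_group "\<lparr>carrier = X, mult = m, one = e\<rparr>"
  by (rule comm_group_X)

lemma X_e [simp]: "e \<in> X"
  and X_closed [simp]: "\<lbrakk>x \<in> X; y \<in> X\<rbrakk> \<Longrightarrow> x \<cdot> y \<in> X"
  and X_comm: "\<lbrakk>x \<in> X; y \<in> X\<rbrakk> \<Longrightarrow> x \<cdot> y = y \<cdot> x"
  and X_assoc: "\<lbrakk>x \<in> X; y \<in> X; z \<in> X\<rbrakk> \<Longrightarrow> x \<cdot> y \<cdot> z = x \<cdot> (y \<cdot> z)"
  and X_left_comm: "\<lbrakk>x \<in> X; y \<in> X; z \<in> X\<rbrakk> \<Longrightarrow> x \<cdot> (y \<cdot> z) = y \<cdot> (x \<cdot> z)"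
  using X.one_closed X.m_closed X.m_comm X.m_assoc X.m_lcomm by simp_all

lemma X_inv:
  assumes "x \<in> X"
  shows "inv\<^bsub>\<lparr>carrier = X, mult = m, one = e\<rparr>\<^esub> x = J x"
proof -
  let ?i = "inv\<^bsub>\<lparr>carrier = X, mult = m, one = e\<rparr>\<^esub> x"
  have "?i \<in> X" "x \<cdot> ?i = e" using X.inv_closed X.r_inv assms by simp_all
  then show ?thesis
    using left_cancel[of x ?i "J x"] linv_right[of x] assms by (simp add: X_subset del: left_cancel)
qed

lemma X_J [simp]: "x \<in> X \<Longrightarrow> J x \<in> X"
  using X.inv_closed[of x] by (simp add: X_inv)

abbreviation F :: "int \<Rightarrow> 'a \<Rightarrow> 'a" where "F n \<equiv> perm_zpow X f n"

lemmas F_closed [simp] = perm_zpow_closed[OF f_bij]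
lemmas F_F [simp] = perm_zpow_zpow[OF f_bij]
lemmas f_eq_F = perm_zpow_1[OF f_bij, symmetric]

lemma F_eq_iff [simp]: "\<lbrakk>x \<in> X; y \<in> X\<rbrakk> \<Longrightarrow> F n x = F n y \<longleftrightarrow> x = y"
  using perm_zpow_inj[OF f_bij] by blast

section \<open>Multiplication of the cosets of X by powers of a\<close>

text \<open>\<open>E n u\<close> is \<open>u a\<^sup>n\<close>, without recourse to diassociativity.\<close>
abbreviation E :: "int \<Rightarrow> 'a \<Rightarrow> 'a" where "E n \<equiv> perm_zpow Q (\<lambda>u. u \<cdot> a) n"

lemma R_bij: "bij_betw (\<lambda>u. u \<cdot> a) Q Q"
proof (rule bij_betw_imageI)
  show "inj_on (\<lambda>u. u \<cdot> a) Q" by (simp add: inj_on_def)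
  show "(\<lambda>u. u \<cdot> a) ` Q = Q"
  proof
    show "Q \<subseteq> (\<lambda>u. u \<cdot> a) ` Q"
    proof
      fix u assume "u \<in> Q"
      then show "u \<in> (\<lambda>u. u \<cdot> a) ` Q" by (intro image_eqI[of _ _ "u \<cdot> J a"]) simp_all
    qed
  qed auto
qed

lemmas E_E [simp] = perm_zpow_zpow[OF R_bij]
lemmas E_plus1 = perm_zpow_plus1[OF R_bij, symmetric]

lemma E_closed [simp]: "u \<in> Q \<Longrightarrow> E n u \<in> Q"
  and E_closed_X [simp]: "u \<in> X \<Longrightarrow> E n u \<in> Q"
  using perm_zpow_closed[OF R_bij] X_subset by auto

lemma E_eq_iff [simp]: "\<lbrakk>x \<in> Q; y \<in> Q\<rbrakk> \<Longrightarrow> E n x = E n y \<longleftrightarrow> x = y"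
  using perm_zpow_inj[OF R_bij] by blast

text \<open>Flexibility allows the factors a on the right to be peeled off one at a time.\<close>

lemma a_E:
  assumes [simp]: "x \<in> X"
  shows "a \<cdot> E n x = E (n + 1) (F 1 x)"
proof (induction n rule: int_induct[where k=0])
  case base
  show ?case using a_left[of x] E_plus1[of "F 1 x" 0] by (simp add: f_eq_F X_subset)
next
  case (step1 i)
  have "a \<cdot> E (i + 1) x = a \<cdot> (E i x \<cdot> a)" by (simp add: E_plus1 X_subset)
  also have "\<dots> = a \<cdot> E i x \<cdot> a" by (rule flexible) simp_all
  also have "\<dots> = E (i + 1 + 1) (F 1 x)" by (simp only: step1 E_plus1 X_subset F_closed assms)
  finally show ?case .
next
  case (step2 i)
  have "a \<cdot> E (i - 1) x \<cdot> a = a \<cdot> (E (i - 1) x \<cdot> a)" by (rule flexible[symmetric]) simp_all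
  also have "\<dots> = E (i - 1 + 1) (F 1 x) \<cdot> a"
    using step2 E_plus1[of x "i - 1"] E_plus1[of "F 1 x" i] by (simp add: X_subset)
  finally show ?case
    using right_cancel[of a "a \<cdot> E (i - 1) x" "E (i - 1 + 1) (F 1 x)"] by simp
qed

text \<open>\<open>T\<^sub>a\<close> is a pseudoautomorphism with companion \<open>a\<^sup>3\<close>.\<close>
lemma mult_E_shift:
  assumes [simp]: "x \<in> X" "y \<in> X" "z \<in> X"
  shows "F 1 x \<cdot> E (n + 3) (F 1 y) = E (n + 3) (F 1 z) \<longleftrightarrow> x \<cdot> E n y = E n z"
proof -
  have [simp]: "x \<in> Q" "y \<in> Q" "z \<in> Q" "F 1 x \<in> Q" by (simp_all add: X_subset)
  \<comment> \<open>Origin of the shift by 3: writing f(y) a^(n+3) as a (y a^(n+1)) a lets the right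
    Bol identity form f(x) a = a x. The Moufang identity then encloses x (y a^n) between two factors
    a, and a third remains on the right.\<close>
  have aEa: "a \<cdot> E k u \<cdot> a = E (k + 2) (F 1 u)" if "u \<in> X" for k u
    using that E_plus1[of "F 1 u" "k + 1"] by (simp add: a_E X_subset add.commute)
  have "F 1 x \<cdot> E (n + 3) (F 1 y) = F 1 x \<cdot> (a \<cdot> E (n + 1) y \<cdot> a)"
    by (simp add: aEa add.commute)
  also have "\<dots> = F 1 x \<cdot> a \<cdot> E (n + 1) y \<cdot> a" by (rule right_bol[symmetric]) simp_all
  also have "F 1 x \<cdot> a \<cdot> E (n + 1) y = (a \<cdot> x) \<cdot> (E n y \<cdot> a)"
    using a_left[of x] by (simp add: E_plus1 f_eq_F)
  also have "\<dots> = a \<cdot> (x \<cdot> E n y) \<cdot> a" by (rule middle) simp_all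
  finally have l: "F 1 x \<cdot> E (n + 3) (F 1 y) = a \<cdot> (x \<cdot> E n y) \<cdot> a \<cdot> a" .
  have "E (n + 3) (F 1 z) = E (n + 2) (F 1 z) \<cdot> a"
    using E_plus1[of "F 1 z" "n + 2"] by (simp add: X_subset add.commute)
  also have "\<dots> = a \<cdot> E n z \<cdot> a \<cdot> a" by (simp add: aEa)
  finally have "E (n + 3) (F 1 z) = a \<cdot> E n z \<cdot> a \<cdot> a" .
  with l show ?thesis by simp
qed

lemma mult_E:
  assumes "x \<in> X" "y \<in> X"
  shows "x \<cdot> E (3 * n) y = E (3 * n) (F n (F (- n) x \<cdot> F (- n) y))"
  using assms
proof (induction n arbitrary: x y rule: int_induct[where k=0])
  case base then show ?case by simp
next
  case (step1 i)
  let ?x = "F (-1) x" and ?y = "F (-1) y"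
  note [simp] = step1.prems
  have "?x \<cdot> E (3 * i) ?y = E (3 * i) (F i (F (- i) ?x \<cdot> F (- i) ?y))"
    using step1 by simp
  then show ?case
    using mult_E_shift[of ?x ?y "F i (F (- i) ?x \<cdot> F (- i) ?y)" "3 * i"]
    by (simp add: algebra_simps)
next
  case (step2 i)
  note [simp] = step2.prems
  let ?z = "F (i - 1) (F (- (i - 1)) x \<cdot> F (- (i - 1)) y)"
  have "F 1 x \<cdot> E (3 * i) (F 1 y) = E (3 * i) (F 1 ?z)"
    using step2(2)[of "F 1 x" "F 1 y"] by (simp add: algebra_simps)
  then show ?case
    using mult_E_shift[of x y ?z "3 * (i - 1)"] by simp
qed

text \<open>The right Bol identity ((u a) v) a = u (a v a), iterated; the outer \<open>E n\<close>
  supplies the factors a on the right that it consumes. The induction changes k and y, hence both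
  are arbitrary.\<close>

lemma E_mult_E:
  assumes "x \<in> X" "y \<in> X"
  shows "E n (E n x \<cdot> E k y) = x \<cdot> E (k + 2 * n) (F n y)"
  using assms(2)
proof (induction n arbitrary: k y rule: int_induct[where k=0])
  case base then show ?case by simp
next
  note [simp] = assms(1)
  case (step1 i)
  note [simp] = step1.prems
  have "E (i + 1) (E (i + 1) x \<cdot> E k y) = E i (E (i + 1) x \<cdot> E k y \<cdot> a)"
    by (simp add: perm_zpow_1[OF R_bij, symmetric])
  also have "E (i + 1) x \<cdot> E k y \<cdot> a = E i x \<cdot> a \<cdot> E k y \<cdot> a"
    by (simp add: E_plus1 X_subset)
  also have "\<dots> = E i x \<cdot> (a \<cdot> E k y \<cdot> a)" by (rule right_bol) simp_all
  also have "a \<cdot> E k y \<cdot> a = E (k + 2) (F 1 y)"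
    using E_plus1[of "F 1 y" "k + 1"] by (simp add: a_E X_subset add.commute)
  finally show ?case
    using step1(2)[of "F 1 y" "k + 2"] by (simp add: algebra_simps)
next
  note [simp] = assms(1)
  case (step2 i)
  note [simp] = step2.prems
  have "E k y = a \<cdot> E (k - 2) (F (-1) y) \<cdot> a"
    using E_plus1[of y "k - 1"] by (simp add: a_E X_subset)
  then have "E (i - 1) x \<cdot> E k y = E (i - 1) x \<cdot> a \<cdot> E (k - 2) (F (-1) y) \<cdot> a"
    by (simp add: right_bol)
  also have "\<dots> = E i x \<cdot> E (k - 2) (F (-1) y) \<cdot> a"
    using E_plus1[of x "i - 1"] by (simp add: X_subset)
  also have "E (i - 1) \<dots> = E i (E i x \<cdot> E (k - 2) (F (-1) y))"
    by (simp add: perm_zpow_1[OF R_bij, symmetric])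
  also have "\<dots> = x \<cdot> E (k + 2 * (i - 1)) (F (i - 1) y)"
    using step2(2)[of "F (-1) y" "k - 2"] by (simp add: algebra_simps)
  finally show ?case .
qed

text \<open>\<open>E_mult_E\<close> collects all powers of a in the right factor, where
  \<open>mult_E\<close> applies with index k + 2n; the auxiliary outer \<open>E (3 * n)\<close> is
  then cancelled.\<close>

lemma E3_mult_E3:
  assumes [simp]: "x \<in> X" "y \<in> X"
  shows "E (3 * n) x \<cdot> E (3 * k) y
    = E (3 * (n + k)) (F (k + 2 * n) (F (- (k + 2 * n)) x \<cdot> F (n - k) y))"
proof -
  have "E (3 * n) (E (3 * n) x \<cdot> E (3 * k) y) = x \<cdot> E (3 * (k + 2 * n)) (F (3 * n) y)"
    by (simp add: E_mult_E algebra_simps)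
  also have "\<dots> = E (3 * (k + 2 * n)) (F (k + 2 * n) (F (- (k + 2 * n)) x \<cdot> F (n - k) y))"
    by (subst mult_E) simp_all
  also have "\<dots> = E (3 * n) (E (3 * (n + k)) (F (k + 2 * n) (F (- (k + 2 * n)) x \<cdot> F (n - k) y)))"
    by (simp add: X_subset algebra_simps)
  finally show ?thesis by (simp del: E_E)
qed

lemma F_e [simp]: "F n e = e"
proof -
  have 1: "F 1 e = e"
    using a_left[of e] right_cancel[of a "f e" e] by (simp add: f_closed X_subset f_eq_F)
  show ?thesis
  proof (induction n rule: int_induct[where k=0])
    case base then show ?case by simp
  next
    case (step1 i)
    then show ?case using F_F[of e 1 i] by (simp add: 1 add.commute del: F_F)
  next
    case (step2 i)
    then have "F 1 (F (i - 1) e) = F 1 e" by (simp add: 1)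
    then show ?case by (simp only: F_eq_iff F_closed X_e)
  qed
qed

lemma E_1_e: "E 1 e = a"
  using perm_zpow_1[OF R_bij, of e] by simp

text \<open>Halving n: \<open>E_mult_E\<close> with n div 2 reduces the claim to right
  multiplication by a^0 or a^1, where it is immediate.\<close>

lemma mult_E_e:
  assumes [simp]: "x \<in> X"
  shows "x \<cdot> E n e = E n x"
proof -
  have n: "n mod 2 + 2 * (n div 2) = n" by simp
  have "n mod 2 = 0 \<or> n mod 2 = 1" by presburger
  then have "E (n div 2) x \<cdot> E (n mod 2) e = E (n mod 2) (E (n div 2) x)"
    using perm_zpow_1[OF R_bij, of "E (n div 2) x"] by (auto simp: E_1_e simp del: E_E)
  then have "E (n div 2) (E (n div 2) x \<cdot> E (n mod 2) e) = E (n mod 2 + 2 * (n div 2)) x"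
    by (simp add: X_subset)
  then show ?thesis by (simp only: E_mult_E X_e assms F_e n)
qed

lemma E_e_mult:
  assumes [simp]: "x \<in> X"
  shows "E n e \<cdot> x = E n (F n x)"
proof -
  have "E n (E n e \<cdot> x) = E n (E n (F n x))" using E_mult_E[of e x n 0] by (simp add: X_subset)
  then show ?thesis by (simp add: X_subset del: E_E)
qed

text \<open>Powers built by left multiplication agree with iterated right multiplication because a
  a^n = a^(n+1) is the case x = e of \<open>a_E\<close>.\<close>

lemma zpow_eq: "zpow Q m e a n = E n e"
proof -
  have "npow m e a k = E (int k) e" for k
    using a_E[of e] by (induction k) (simp_all add: add.commute)
  moreover have "npow m e (J a) k = E (- int k) e" for k
  proof (induction k)
    case (Suc k)
    have "a \<cdot> E (- int (Suc k)) e = E (- int k) e"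
      using a_E[of e "- int (Suc k)"] by simp
    moreover have "J a \<cdot> (a \<cdot> E (- int (Suc k)) e) = E (- int (Suc k)) e"
      by (rule left_inverse_cancel) simp_all
    ultimately show ?case by (simp only: npow.simps Suc)
  qed simp
  ultimately show ?thesis by (simp add: zpow_def)
qed

section \<open>Three loop identities read as properties of f\<close>

lemma F_square:
  assumes [simp]: "x \<in> X"
  shows "F 1 (x \<cdot> x) = F 1 x \<cdot> F 1 x"
proof -
  let ?y = "F 1 x"
  \<comment> \<open>The left alternative law compares (y +_1 y) a^3 with (y + y) a^3; for y = f(x)
    the former is f(x + x) a^3.\<close>
  have "?y \<cdot> (?y \<cdot> E 3 e) = ?y \<cdot> ?y \<cdot> E 3 e" by (rule left_alternative) (simp_all add: X_subset)
  moreover have "?y \<cdot> E 3 ?y = E 3 (F 1 (x \<cdot> x))" using mult_E[of ?y ?y 1] by simp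
  ultimately show ?thesis by (simp add: mult_E_e X_subset)
qed

text \<open>The Moufang identity \<open>xu\<cdot>vx = (x\<cdot>uv)x\<close> for \<open>u = ya\<^sup>-\<^sup>3\<close>, \<open>v = f\<^sup>3(z)a\<^sup>6\<close>: the right-hand
  side depends on \<open>yz\<close> only.\<close>
lemma F_shift:
  assumes [simp]: "x \<in> X" "y \<in> X" "z \<in> X"
  shows "F (-1) (F 1 x \<cdot> F 1 y) \<cdot> F 1 (F (-1) z \<cdot> F 2 x) = x \<cdot> F 1 (F (-1) (y \<cdot> z) \<cdot> F 2 x)"
proof -
  have main: "E 3 (F (-1) (F 1 x \<cdot> F 1 y) \<cdot> F 1 (F (-1) z \<cdot> F 2 x)) = x \<cdot> E 3 (y \<cdot> z) \<cdot> x"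
    if [simp]: "y \<in> X" "z \<in> X" for y z
  proof -
    let ?p = "F (-1) (F 1 x \<cdot> F 1 y)" and ?q = "F 4 (F (-1) z \<cdot> F 2 x)"
    have "x \<cdot> E (-3) y = E (-3) ?p" using mult_E[of x y "-1"] by simp
    moreover have "E 6 (F 3 z) \<cdot> x = E 6 ?q" using E3_mult_E3[of "F 3 z" x 2 0] by simp
    \<comment> \<open>Here and in the next product k + 2n = 0, so the coset product is plain
      multiplication in X, up to \<open>F (-3)\<close> on the right factor.\<close>
    moreover have "E (-3) ?p \<cdot> E 6 ?q = E 3 (?p \<cdot> F (-3) ?q)"
      using E3_mult_E3[of ?p ?q "-1" 2] by simp
    moreover have "E (-3) y \<cdot> E 6 (F 3 z) = E 3 (y \<cdot> z)"
      using E3_mult_E3[of y "F 3 z" "-1" 2] by simp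
    moreover have "(x \<cdot> E (-3) y) \<cdot> (E 6 (F 3 z) \<cdot> x) = x \<cdot> (E (-3) y \<cdot> E 6 (F 3 z)) \<cdot> x"
      by (rule middle) (simp_all add: X_subset)
    ultimately show ?thesis by simp
  qed
  \<comment> \<open>The pairs (y, z) and (e, y z) have the same right-hand side in
    \<open>main\<close>; for the second one the first factor collapses to x.\<close>
  have "E 3 (F (-1) (F 1 x \<cdot> F 1 y) \<cdot> F 1 (F (-1) z \<cdot> F 2 x))
      = E 3 (F (-1) (F 1 x \<cdot> F 1 e) \<cdot> F 1 (F (-1) (y \<cdot> z) \<cdot> F 2 x))"
    using main[of y z] main[of e "y \<cdot> z"] by (simp add: X_subset)
  then show ?thesis by (simp add: X_subset)
qed

text \<open>The automorphism \<open>u \<mapsto> x(y((xy)\<^sup>-\<^sup>1u))\<close> fixes \<open>X\<close> pointwise, so its image \<open>E 3 (F 1 c)\<close>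
  of \<open>a\<^sup>3\<close> still induces \<open>f\<^sup>3\<close> on \<open>X\<close>.\<close>
lemma F_radical:
  assumes [simp]: "x \<in> X" "y \<in> X" "v \<in> X" and c: "c = F (-1) x \<cdot> F (-1) y \<cdot> F (-1) (J (x \<cdot> y))"
  shows "F 1 (F (-1) c \<cdot> F (-1) v) = c \<cdot> v"
proof -
  let ?t = "J (x \<cdot> y)"
  \<comment> \<open>The final comparison involves f(z) and f^2(z), which become f^-1(v) and
    v.\<close>
  define z where "z = F (-2) v"
  have v: "v = F 2 z" and [simp]: "z \<in> X" "c \<in> X" by (simp_all add: z_def c)
  have [simp]: "x \<in> Q" "y \<in> Q" "z \<in> Q" "x \<cdot> y \<in> X" by (simp_all add: X_subset)
  have hom: "x \<cdot> (y \<cdot> (?t \<cdot> (p \<cdot> q))) = (x \<cdot> (y \<cdot> (?t \<cdot> p))) \<cdot> (x \<cdot> (y \<cdot> (?t \<cdot> q)))"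
    if "p \<in> Q" "q \<in> Q" for p q
  proof (rule inner_map_hom)
    \<comment> \<open>All factors lie in the abelian group X, so the expression is the square of x y
      w, which is e when w inverts x y.\<close>
    have "x \<cdot> (y \<cdot> (w \<cdot> w) \<cdot> y) \<cdot> x = (x \<cdot> y \<cdot> w) \<cdot> (x \<cdot> y \<cdot> w)" if "w \<in> X" for w
      using that by (simp add: X_assoc X_comm X_left_comm)
    from this[of ?t] show "x \<cdot> (y \<cdot> (?t \<cdot> ?t) \<cdot> y) \<cdot> x = e" by simp
  qed (use that X_comm in simp_all)
  have fix_X: "x \<cdot> (y \<cdot> (?t \<cdot> w)) = w" if "w \<in> X" for w
  proof -
    have "x \<cdot> (y \<cdot> (?t \<cdot> w)) = (x \<cdot> y) \<cdot> (?t \<cdot> w)" using that by (simp add: X_assoc)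
    then show ?thesis using that by (simp add: X_subset)
  qed
  have "?t \<cdot> E 3 e = E 3 ?t" by (rule mult_E_e) simp
  moreover have "y \<cdot> E 3 ?t = E 3 (F 1 (F (-1) y \<cdot> F (-1) ?t))" using mult_E[of y ?t 1] by simp
  moreover have "x \<cdot> E 3 (F 1 (F (-1) y \<cdot> F (-1) ?t)) = E 3 (F 1 c)"
    using mult_E[of x "F 1 (F (-1) y \<cdot> F (-1) ?t)" 1] by (simp add: X_assoc c)
  ultimately have b: "x \<cdot> (y \<cdot> (?t \<cdot> E 3 e)) = E 3 (F 1 c)" by (simp only:)
  have "E 3 e \<cdot> z = F 3 z \<cdot> E 3 e" by (simp add: E_e_mult mult_E_e)
  then have "(x \<cdot> (y \<cdot> (?t \<cdot> E 3 e))) \<cdot> (x \<cdot> (y \<cdot> (?t \<cdot> z)))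
      = (x \<cdot> (y \<cdot> (?t \<cdot> F 3 z))) \<cdot> (x \<cdot> (y \<cdot> (?t \<cdot> E 3 e)))"
    using hom[of "E 3 e" z] hom[of "F 3 z" "E 3 e"] by (simp only: E_closed_X X_subset F_closed X_e \<open>z \<in> X\<close>)
  then have "E 3 (F 1 c) \<cdot> z = F 3 z \<cdot> E 3 (F 1 c)"
    by (simp only: b fix_X F_closed \<open>z \<in> X\<close>)
  moreover have "E 3 (F 1 c) \<cdot> z = E 3 (F 2 (F (-1) c \<cdot> F 1 z))"
    using E3_mult_E3[of "F 1 c" z 1 0] by simp
  moreover have "F 3 z \<cdot> E 3 (F 1 c) = E 3 (F 1 (F 2 z \<cdot> c))"
    using mult_E[of "F 3 z" "F 1 c" 1] by simp
  ultimately have "F 2 (F (-1) c \<cdot> F 1 z) = F 1 (F 2 z \<cdot> c)" by (simp add: X_subset)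
  then have "F (-1) (F 2 (F (-1) c \<cdot> F 1 z)) = F (-1) (F 1 (F 2 z \<cdot> c))" by simp
  then show ?thesis by (simp add: v X_comm)
qed

lemma perm_of_comm_group_X: "perm_of_comm_group \<lparr>carrier = X, mult = m, one = e\<rparr> f"
  using comm_group_X f_bij by (simp add: perm_of_comm_group_def perm_of_comm_group_axioms_def)

lemma moufang_perm_f: "moufang_perm \<lparr>carrier = X, mult = m, one = e\<rparr> f"
  by (rule perm_of_comm_group.moufang_permI[OF perm_of_comm_group_X])
     (simp_all add: F_square F_shift X_inv F_radical)

lemma moufang_perm_group_X: "moufang_perm_group \<lparr>carrier = X, mult = m, one = e\<rparr> f"
  using perm_of_comm_group_X moufang_perm_f
  by (simp add: moufang_perm_group_def moufang_perm_group_axioms_def)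

text \<open>Moving a^(3(i+j)) to the left applies f^(-3(i+j)), which turns the outer exponent 2i + j
  from \<open>E3_mult_E3\<close> into -(i + 2j), the form treated by the sum formula.\<close>

lemma coset_mult_left_right:
  assumes [simp]: "x \<in> X" "y \<in> X"
  shows "(E (3 * i) e \<cdot> x) \<cdot> (y \<cdot> E (3 * j) e) = E (3 * (i + j)) e \<cdot>
    F (- (i + 2 * j)) (F (i + 2 * j) (F (- 3 * j) x) \<cdot> F (i + 2 * j) (F (- 3 * j) y))"
  by (simp add: E_e_mult mult_E_e E3_mult_E3) (simp add: algebra_simps)

lemma coset_mult_left_left:
  assumes [simp]: "x \<in> X" "y \<in> X"
  shows "(E (3 * i) e \<cdot> x) \<cdot> (E (3 * j) e \<cdot> y) = E (3 * (i + j)) e \<cdot>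
    F (- (i + 2 * j)) (F (i + 2 * j) (F (- 3 * j) x) \<cdot> F (i + 2 * j) y)"
  by (simp add: E_e_mult mult_E_e E3_mult_E3) (simp add: algebra_simps)

end

theorem mainTheorem15:
  fixes Q :: "'a set" and m :: "'a \<Rightarrow> 'a \<Rightarrow> 'a" and e :: 'a and X :: "'a set" and a :: 'a
  defines "G \<equiv> \<lparr>carrier = X, mult = m, one = e\<rparr>"
  defines "f \<equiv> restrict (Tmap Q m a) X"
  assumes "moufang_loop Q m e"
    and "normal_subloop Q m e X"
    and "comm_group G"
    and "a \<in> Q"
  shows "moufang_perm G f
    \<and> (\<forall>(i::int) (j::int). \<forall>x\<in>X. \<forall>y\<in>X.
         m (m (zpow Q m e a (3*i)) x) (m y (zpow Q m e a (3*j)))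
           = m (zpow Q m e a (3*(i+j)))
               (perm_zpow X f (-3*j) x \<otimes>\<^bsub>G\<^esub> perm_zpow X f (-3*j) y
                 \<otimes>\<^bsub>G\<^esub> (\<Otimes>\<^bsub>G\<^esub> k\<in>Iset (-2*j) i. perm_zpow X f (-3*k) (mbeta G f x y)))
       \<and> m (m (zpow Q m e a (3*i)) x) (m (zpow Q m e a (3*j)) y)
           = m (zpow Q m e a (3*(i+j)))
               (perm_zpow X f (-3*j) x \<otimes>\<^bsub>G\<^esub> y
                 \<otimes>\<^bsub>G\<^esub> (\<Otimes>\<^bsub>G\<^esub> k\<in>Iset (i+j) (-j). perm_zpow X f (-3*k) (mbeta G f x y))))"
proof -
  interpret L: moufang_abelian_normal Q m e X a
    using assms
    by (simp add: moufang_abelian_normal_def moufang_abelian_normal_axioms_def moufang_def)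
  have f: "f = L.f" by (simp add: f_def L.f_def)
  interpret P: moufang_perm_group G f
    unfolding G_def f by (rule L.moufang_perm_group_X)
  have G: "carrier G = X" "mult G = m" by (simp_all add: G_def)
  note both = P.F_conj_F3_both[unfolded G, folded f] and left = P.F_conj_F3_left[unfolded G, folded f]
  show ?thesis
  proof (intro conjI allI ballI)
    show "moufang_perm G f" by (rule P.moufang)
  qed (simp_all only: G L.zpow_eq L.coset_mult_left_right[folded f]
      L.coset_mult_left_left[folded f] both left)
qed

end
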